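(* For $z_{j}\in\mathbb{C}\setminus\{0,-1,-2, \ldots\}$ ($j=1,\ldots,n$), we have \begin{equation*} \prod_{m=0}^{\infty}\left\{\prod_{j=1}^{n}(m+z_{j})\right\}^{(-1)^{m}}=\frac{\left(\sqrt{\frac{\pi}{2}}\right)^n}{\prod_{j=1}^{n}\tilde\Gamma(z_{j})}. \end{equation*}
   Context: Here $\tilde\Gamma(z)$ is the modified gamma function, defined by $\frac{d}{dz}\log\tilde\Gamma(z)=\tilde\psi(z)$ for $\mathrm{Re}(z)>0$, where $\tilde\psi(z)=-\psi(z)+\psi(z/2)+\log 2$ ($\psi$ the classical digamma function); equivalently $\tilde\psi(z)=-\tilde\gamma_0(z)$, the constant term of the Taylor expansion at $s=1$ of the alternating Hurwitz zeta function $\zeta_E(s,z)=\sum_{m\ge0}(-1)^m(m+z)^{-s}$. It has the Weierstrass--Hadamard product $\tilde\Gamma(z)=\frac1z e^{\tilde\gamma_0 z}\prod_{m=1}^\infty\left(e^{-\frac zm}\left(1+\frac zm\right)\right)^{(-1)^{m+1}}$, where $\tilde\gamma_0=\tilde\gamma_0(1)=\frac12+\frac12\sum_{j=1}^\infty(-1)^{j+1}\frac{1}{j(j+1)}$ is the modified Euler constant. The infinite product on the left is understood in the sense of (alternating) zeta regularization: it is defined as $\exp\left(\frac{\partial}{\partial s}\Lambda^{*}(s)\big|_{s=0}\right)$, where $\Lambda^{*}(s)=\sum_{m=0}^{\infty}(-1)^{m+1}\prod_{j=1}^{n}(m+z_{j})^{-s}$ for $\mathrm{Re}(s)>0$, analytically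 continued to a neighborhood of $s=0$. *)

theory Defs
  imports "HOL-Complex_Analysis.Complex_Analysis"
begin

section \<open>The modified gamma function\<close>

definition mod_digamma :: "complex \<Rightarrow> complex" where
  "mod_digamma z = - Digamma z + Digamma (z / 2) + of_real (ln 2)"

definition mod_euler_const :: real where
  "mod_euler_const =
     1/2 + 1/2 * (\<Sum>j. (-1) ^ (Suc j + 1) / (real (Suc j) * (real (Suc j) + 1)))"

text \<open>
  The logarithmic derivative determines the modified gamma function only up to a constant
  factor, and only for positive real part.  The Weierstrass--Hadamard product fixes the
  constant and gives the extension to the left half-plane, so it serves as the definition;
  the logarithmic derivative is recovered below in \<open>has_field_derivative_mod_Gamma\<close>.
  The index \<open>k\<close> of the product corresponds to \<open>m = k + 1\<close>.
\<close>
definition mod_Gamma :: "complex \<Rightarrow> complex" where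
  "mod_Gamma z = 1 / z * exp (of_real mod_euler_const * z) *
     (\<Prod>k. (exp (- z / of_nat (Suc k)) * (1 + z / of_nat (Suc k))) powi ((-1) ^ (Suc k + 1)))"


section \<open>Alternating zeta regularization\<close>

text \<open>Complex powers use the principal branch of the logarithm.\<close>

definition alt_zeta_term :: "nat \<Rightarrow> (nat \<Rightarrow> complex) \<Rightarrow> complex \<Rightarrow> nat \<Rightarrow> complex" where
  "alt_zeta_term n z s m = (-1) ^ (m + 1) * (\<Prod>j=1..n. (of_nat m + z j) powr (- s))"

definition alt_zeta_continuation ::
    "nat \<Rightarrow> (nat \<Rightarrow> complex) \<Rightarrow> (complex \<Rightarrow> complex) \<Rightarrow> bool" where
  "alt_zeta_continuation n z F \<longleftrightarrow>
     (\<exists>U. open U \<and> connected U \<and> {s. Re s > 0} \<union> {0} \<subseteq> U \<and> F holomorphic_on U \<and>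
          (\<forall>s. Re s > 0 \<longrightarrow> alt_zeta_term n z s sums F s))"

text \<open>
  The regularized value of \<open>\<Prod>\<^sub>m (\<Prod>\<^sub>j (m + z\<^sub>j)) ^ (-1)\<^sup>m\<close>.  It depends on the family \<open>z\<close> and not
  just on the inner products, since the branch is chosen factor by factor.  It is meaningful
  only if a continuation exists, and is then independent of the continuation.
\<close>
definition alt_zeta_prod :: "nat \<Rightarrow> (nat \<Rightarrow> complex) \<Rightarrow> complex" where
  "alt_zeta_prod n z = (THE P. \<exists>F. alt_zeta_continuation n z F \<and> P = exp (deriv F 0))"

lemma alt_zeta_continuation_unique:
  assumes "alt_zeta_continuation n z F" "alt_zeta_continuation n z G"
  shows   "deriv F 0 = deriv G 0"
proof -
  obtain U where U: "open U" "{s. Re s > 0} \<union> {0} \<subseteq> U" "F holomorphic_on U"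
      "\<And>s. Re s > 0 \<Longrightarrow> alt_zeta_term n z s sums F s"
    using assms(1) unfolding alt_zeta_continuation_def by blast
  obtain V where V: "open V" "{s. Re s > 0} \<union> {0} \<subseteq> V" "G holomorphic_on V"
      "\<And>s. Re s > 0 \<Longrightarrow> alt_zeta_term n z s sums G s"
    using assms(2) unfolding alt_zeta_continuation_def by blast
  have "open (U \<inter> V)" "0 \<in> U \<inter> V"
    using U V by auto
  then obtain r where r: "r > 0" "ball 0 r \<subseteq> U \<inter> V"
    by (meson openE)
  define S where "S = ball (0::complex) r \<inter> {s. Re s > 0}"
  have "of_real (r / 2) \<in> S"
    using r by (auto simp: S_def)
  hence S_ne: "S \<noteq> {}" by blast
  have "open S"
    unfolding S_def by (intro open_Int open_ball open_halfspace_Re_gt)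
  have eq: "F s = G s" if "s \<in> ball 0 r" for s
  proof (rule analytic_continuation_open[of S "ball 0 r" F G])
    show "F holomorphic_on ball 0 r" "G holomorphic_on ball 0 r"
      using U(3) V(3) r(2) holomorphic_on_subset by blast+
    show "F w = G w" if "w \<in> S" for w
      using that U(4)[of w] V(4)[of w] sums_unique2 by (auto simp: S_def)
  qed (use \<open>open S\<close> S_ne that in \<open>auto simp: S_def\<close>)
  have "eventually (\<lambda>s. s \<in> ball 0 r) (nhds (0::complex))"
    using r(1) by (intro eventually_nhds_in_open) auto
  hence "eventually (\<lambda>s. F s = G s) (nhds 0)"
    by eventually_elim (rule eq)
  thus ?thesis
    by (intro deriv_cong_ev) auto
qed

lemma alt_zeta_prod_eqI:
  assumes "alt_zeta_continuation n z F"
  shows   "alt_zeta_prod n z = exp (deriv F 0)"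
  unfolding alt_zeta_prod_def
proof (rule the_equality)
  fix P assume "\<exists>F. alt_zeta_continuation n z F \<and> P = exp (deriv F 0)"
  then obtain G where "alt_zeta_continuation n z G" "P = exp (deriv G 0)" by blast
  thus "P = exp (deriv F 0)"
    using alt_zeta_continuation_unique[OF assms] by metis
qed (use assms in blast)


section \<open>Consistency of the product with the logarithmic derivative\<close>

lemma mod_euler_const_eq: "mod_euler_const = ln 2"
proof -
  have 1: "(\<lambda>k. (-1)^k / real (Suc k)) sums ln 2"
    by (rule alternating_harmonic_series_sums)
  have "(\<lambda>k. (-1)^(Suc k) / real (Suc (Suc k))) sums (ln 2 - 1)"
    using 1 sums_Suc_iff[of "\<lambda>k. (-1)^k / real (Suc k)" "ln 2 - 1"] by simp
  hence "(\<lambda>k. (-1)^k / real (Suc k) + (-1)^(Suc k) / real (Suc (Suc k))) sums (ln 2 + (ln 2 - 1))"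
    by (intro sums_add 1)
  also have "(\<lambda>k. (-1)^k / real (Suc k) + (-1)^(Suc k) / real (Suc (Suc k))) =
             (\<lambda>j. (-1) ^ (Suc j + 1) / (real (Suc j) * (real (Suc j) + 1)))"
    by (rule ext) (simp add: divide_simps, simp add: algebra_simps)
  finally show ?thesis
    unfolding mod_euler_const_def by (simp add: sums_iff field_simps)
qed

lemma mod_Gamma_has_prod:
  fixes z :: complex
  assumes z: "z \<notin> \<int>\<^sub>\<le>\<^sub>0"
  shows "(\<lambda>k. (exp (- z / of_nat (Suc k)) * (1 + z / of_nat (Suc k))) powi ((-1) ^ (Suc k + 1)))
           has_prod (z / 4 * Gamma (z / 2) ^ 2 / Gamma z)"
proof -
  define E where "E = (\<lambda>w k. exp (- w / of_nat k) * (1 + w / of_nat k) :: complex)"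
  define f where "f = (\<lambda>k. E z (Suc k) powi ((-1) ^ (Suc k + 1)))"
  define W where "W = (Gamma_series_Weierstrass :: complex \<Rightarrow> nat \<Rightarrow> complex)"
  define L where "L = z / 4 * Gamma (z / 2) ^ 2 / Gamma z"
  have z2: "z / 2 \<notin> \<int>\<^sub>\<le>\<^sub>0"
  proof
    assume "z / 2 \<in> \<int>\<^sub>\<le>\<^sub>0"
    then obtain k where "z / 2 = - of_nat k" by (auto elim!: nonpos_Ints_cases')
    hence "z = - of_nat (2 * k)" by (simp add: field_simps)
    thus False using z by (metis minus_of_nat_in_nonpos_Ints)
  qed
  have z0: "z \<noteq> 0" using z by auto
  have E_half: "E z (2 * k) = E (z / 2) k" for k
    by (simp add: E_def field_simps)
  have prodE: "(\<Prod>k=1..N. E w k) = exp (- euler_mascheroni * w) / w / W w N"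
    if "w \<noteq> 0" for w N
  proof -
    have "W w N = exp (- euler_mascheroni * w) / w * (\<Prod>k=1..N. inverse (E w k))"
      unfolding W_def Gamma_series_Weierstrass_def
      by (simp add: E_def exp_minus field_simps)
    also have "(\<Prod>k=1..N. inverse (E w k)) = inverse (\<Prod>k=1..N. E w k)"
      using prod_inversef[of "E w" "{1..N}"] by (simp add: o_def)
    finally show ?thesis using that by (simp add: field_simps)
  qed
  have E_nz: "E z k \<noteq> 0" if "k \<ge> 1" for k
  proof
    assume "E z k = 0"
    hence "1 + z / of_nat k = 0" by (simp add: E_def)
    hence "z = - of_nat k" using that by (simp add: divide_simps add_eq_0_iff split: if_splits)
    thus False using z by (metis minus_of_nat_in_nonpos_Ints)
  qed
  have even: "(\<Prod>i<2*N. f i) = (\<Prod>k=1..2*N. E z k) / (\<Prod>k=1..N. E (z / 2) k) ^ 2" for N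
  proof (induction N)
    case (Suc N)
    have "(\<Prod>i<2 * Suc N. f i) = (\<Prod>i<2*N. f i) * f (2*N) * f (Suc (2*N))"
      by simp
    also have "f (2*N) = E z (2*N+1)" by (simp add: f_def)
    also have "f (Suc (2*N)) = inverse (E z (2*N+2))" by (simp add: f_def)
    finally have *: "(\<Prod>i<2 * Suc N. f i) =
        (\<Prod>i<2*N. f i) * E z (2*N+1) * inverse (E z (2*N+2))" .
    have "E z (2*N+2) = E (z / 2) (Suc N)" using E_half[of "Suc N"] by simp
    moreover have "E z (2*N+2) \<noteq> 0" by (rule E_nz) auto
    moreover have "(\<Prod>k=1..2 * Suc N. E z k) = (\<Prod>k=1..2*N. E z k) * E z (2*N+1) * E z (2*N+2)"
      by simp
    moreover have "(\<Prod>k=1..Suc N. E (z/2) k) = (\<Prod>k=1..N. E (z/2) k) * E (z/2) (Suc N)"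
      by simp
    ultimately show ?case
      unfolding * Suc.IH by (simp add: power2_eq_square field_simps)
  qed simp
  have even_lim: "(\<lambda>N. \<Prod>i<2*N. f i) \<longlonglongrightarrow> L"
  proof -
    have Wz: "(\<lambda>N. W z (2*N)) \<longlonglongrightarrow> Gamma z"
      using LIMSEQ_subseq_LIMSEQ[OF Gamma_Weierstrass_complex, of "\<lambda>N. 2*N" z]
      by (simp add: W_def strict_mono_def o_def)
    have Wz2: "(\<lambda>N. W (z/2) N) \<longlonglongrightarrow> Gamma (z/2)"
      using Gamma_Weierstrass_complex by (simp add: W_def)
    have "(\<lambda>N. (exp (- euler_mascheroni * z) / z / W z (2*N)) /
               (exp (- euler_mascheroni * (z/2)) / (z/2) / W (z/2) N) ^ 2) \<longlonglongrightarrow>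
          (exp (- euler_mascheroni * z) / z / Gamma z) /
               (exp (- euler_mascheroni * (z/2)) / (z/2) / Gamma (z/2)) ^ 2"
      by (intro tendsto_intros Wz Wz2) (use z z2 z0 in \<open>auto simp: Gamma_eq_zero_iff\<close>)
    moreover have "exp (- euler_mascheroni * z) = exp (- euler_mascheroni * (z/2)) ^ 2"
      by (simp flip: exp_of_nat_mult)
    hence "(exp (- euler_mascheroni * z) / z / Gamma z) /
               (exp (- euler_mascheroni * (z/2)) / (z/2) / Gamma (z/2)) ^ 2 = L"
      using z0 by (simp add: L_def power2_eq_square field_simps)
    moreover have "z / 2 \<noteq> 0" using z0 by simp
    ultimately show ?thesis
      by (simp only: even prodE[OF z0] prodE[OF \<open>z / 2 \<noteq> 0\<close>])
  qed
  have E_lim: "(\<lambda>N. E z (2*N+1)) \<longlonglongrightarrow> 1"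
  proof -
    have inv: "(\<lambda>N. z / of_nat (2*N+1)) \<longlonglongrightarrow> 0"
      using LIMSEQ_subseq_LIMSEQ[OF lim_const_over_n[of z], of "\<lambda>N. 2*N+1"]
      by (simp add: strict_mono_def o_def)
    have "(\<lambda>N. exp (- (z / of_nat (2*N+1))) * (1 + z / of_nat (2*N+1))) \<longlonglongrightarrow> exp (- 0) * (1 + 0)"
      by (intro tendsto_intros inv)
    thus ?thesis by (simp add: E_def)
  qed
  have odd_lim: "(\<lambda>N. \<Prod>i<2*N+1. f i) \<longlonglongrightarrow> L"
    using tendsto_mult[OF even_lim E_lim] by (simp add: f_def)
  have "(\<lambda>N. \<Prod>i<N. f i) \<longlonglongrightarrow> L"
    unfolding tendsto_def
  proof (intro allI impI)
    fix S assume S: "open S" "L \<in> S"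
    obtain A where A: "\<And>N. N \<ge> A \<Longrightarrow> (\<Prod>i<2*N. f i) \<in> S"
      using topological_tendstoD[OF even_lim S] by (auto simp: eventually_at_top_linorder)
    obtain B where B: "\<And>N. N \<ge> B \<Longrightarrow> (\<Prod>i<2*N+1. f i) \<in> S"
      using topological_tendstoD[OF odd_lim S] by (auto simp: eventually_at_top_linorder)
    have "(\<Prod>i<N. f i) \<in> S" if "N \<ge> 2 * (A + B) + 1" for N
    proof (cases "even N")
      case True
      thus ?thesis using A[of "N div 2"] that by auto
    next
      case False
      thus ?thesis using B[of "N div 2"] that by auto
    qed
    thus "eventually (\<lambda>N. (\<Prod>i<N. f i) \<in> S) sequentially"
      by (auto simp: eventually_at_top_linorder)
  qed
  hence "(\<lambda>N. \<Prod>i\<le>N. f i) \<longlonglongrightarrow> L"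
    by (subst (asm) filterlim_sequentially_Suc [symmetric]) (simp add: lessThan_Suc_atMost)
  moreover have "L \<noteq> 0"
    using z z2 z0 by (auto simp: L_def Gamma_eq_zero_iff)
  ultimately have "f has_prod L"
    by (simp add: has_prod_def raw_has_prod_def)
  thus ?thesis by (simp add: f_def E_def L_def)
qed

lemma mod_Gamma_eq:
  assumes "z \<notin> \<int>\<^sub>\<le>\<^sub>0"
  shows   "mod_Gamma z = exp (of_real (ln 2) * z) / 4 * Gamma (z / 2) ^ 2 / Gamma z"
proof -
  have "z \<noteq> 0" using assms by auto
  thus ?thesis
    unfolding mod_Gamma_def mod_euler_const_eq
      has_prod_unique[OF mod_Gamma_has_prod[OF assms], symmetric]
    by simp
qed

lemma mod_Gamma_nonzero:
  assumes "z \<notin> \<int>\<^sub>\<le>\<^sub>0"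
  shows   "mod_Gamma z \<noteq> 0"
proof -
  have "z / 2 \<notin> \<int>\<^sub>\<le>\<^sub>0"
  proof
    assume "z / 2 \<in> \<int>\<^sub>\<le>\<^sub>0"
    then obtain k where "z / 2 = - of_nat k" by (auto elim!: nonpos_Ints_cases')
    hence "z = - of_nat (2 * k)" by (simp add: field_simps)
    thus False using assms by (metis minus_of_nat_in_nonpos_Ints)
  qed
  thus ?thesis using assms by (simp add: mod_Gamma_eq Gamma_eq_zero_iff)
qed

lemma has_field_derivative_mod_Gamma:
  assumes "Re z > 0"
  shows   "(mod_Gamma has_field_derivative mod_Gamma z * mod_digamma z) (at z)"
proof -
  have pos: "w \<notin> \<int>\<^sub>\<le>\<^sub>0" if "Re w > 0" for w :: complex
    using that by (auto elim!: nonpos_Ints_cases')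
  have nz: "z \<notin> \<int>\<^sub>\<le>\<^sub>0" "z / 2 \<notin> \<int>\<^sub>\<le>\<^sub>0"
    using assms by (auto intro!: pos)
  define A where "A = (\<lambda>z::complex. exp (of_real (ln 2) * z) / 4)"
  define B where "B = (\<lambda>z::complex. Gamma (z / 2))"
  have A: "(A has_field_derivative A z * of_real (ln 2)) (at z)"
    unfolding A_def by (auto intro!: derivative_eq_intros)
  have B: "(B has_field_derivative B z * Digamma (z / 2) * (1 / 2)) (at z)"
    unfolding B_def using nz(2) by (auto intro!: derivative_eq_intros)
  have G: "(Gamma has_field_derivative Gamma z * Digamma z) (at z)"
    using nz(1) by (rule has_field_derivative_Gamma)
  have G_nz: "Gamma z \<noteq> 0"
    using nz(1) by (simp add: Gamma_eq_zero_iff)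
  have "((\<lambda>z. A z * (B z * B z) / Gamma z) has_field_derivative
          A z * (B z * B z) / Gamma z * mod_digamma z) (at z)"
    by (rule DERIV_cong[OF DERIV_divide[OF DERIV_mult[OF A DERIV_mult[OF B B]] G G_nz]])
       (use G_nz in \<open>simp add: mod_digamma_def divide_simps; (simp add: algebra_simps)?\<close>)
  hence deriv: "((\<lambda>z. exp (of_real (ln 2) * z) / 4 * Gamma (z / 2) ^ 2 / Gamma z)
          has_field_derivative mod_Gamma z * mod_digamma z) (at z)"
    unfolding mod_Gamma_eq[OF nz(1)] power2_eq_square A_def B_def .
  have "eventually (\<lambda>w. w \<in> {w. Re w > 0}) (nhds z)"
    using assms by (intro eventually_nhds_in_open open_halfspace_Re_gt) auto
  hence ev: "eventually (\<lambda>w. mod_Gamma w = exp (of_real (ln 2) * w) / 4 * Gamma (w / 2) ^ 2 / Gamma w) (nhds z)"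
    by eventually_elim (use pos mod_Gamma_eq in auto)
  show ?thesis
    using DERIV_cong_ev[OF refl ev refl] deriv by (rule iffD2)
qed

end

theory Submission
  imports Defs
begin

text \<open>
  Write \<open>h\<^sub>s(w) = \<Prod>\<^sub>j (w + z\<^sub>j)\<^sup>-\<^sup>s\<close>.  Averaging consecutive partial sums of the alternating series gives
  \<open>- h\<^sub>s(0)/2 - 1/2 \<Sum>\<^sub>k (h\<^sub>s(2k) - 2 h\<^sub>s(2k+1) + h\<^sub>s(2k+2))\<close>.  By Cauchy's estimate on a disc of radius
  comparable to \<open>k\<close>, the second differences are \<open>O(k\<^sup>-\<^sup>3\<^sup>/\<^sup>2)\<close> locally uniformly for \<open>Re s > - 1/(2n)\<close>, so
  this series is the continuation.  Its derivative at \<open>0\<close> is the limit of the derivatives of the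
  partial sums, which are additive in \<open>j\<close>; after exponentiation each factor is a Wallis-type
  product tending to \<open>\<surd>2 \<Gamma>((z+1)/2) / \<Gamma>(z/2)\<close>, which the duplication formula turns into
  \<open>\<surd>(\<pi>/2)\<close> over the modified gamma function.
\<close>

section \<open>Alternating sums and second differences\<close>

lemma tendsto_even_odd:
  assumes "(\<lambda>n. f (2 * n)) \<longlonglongrightarrow> l" and "(\<lambda>n. f (2 * n + 1)) \<longlonglongrightarrow> l"
  shows "f \<longlonglongrightarrow> l"
  unfolding tendsto_def
proof (intro allI impI)
  fix S assume S: "open S" "l \<in> S"
  obtain A where A: "\<And>n. n \<ge> A \<Longrightarrow> f (2 * n) \<in> S"
    using topological_tendstoD[OF assms(1) S] by (auto simp: eventually_at_top_linorder)
  obtain B where B: "\<And>n. n \<ge> B \<Longrightarrow> f (2 * n + 1) \<in> S"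
    using topological_tendstoD[OF assms(2) S] by (auto simp: eventually_at_top_linorder)
  have "f n \<in> S" if "n \<ge> 2 * (A + B) + 1" for n
    using A[of "n div 2"] B[of "n div 2"] that by (cases "even n") auto
  thus "eventually (\<lambda>n. f n \<in> S) sequentially"
    by (auto simp: eventually_at_top_linorder)
qed

text \<open>The second difference is the increment of \<open>g w = h (w + 1) - h w\<close> over the
  segment from \<open>c - 1\<close> to \<open>c\<close>, and the derivative of \<open>g\<close> is
  an increment of \<open>deriv h\<close>; two mean value estimates reduce the claim to a bound on
  the second derivative over \<open>cball c 1\<close>. Cauchy's inequality with radius
  \<open>r / 2\<close> gives 2 * B / (r / 2)^2, and \<open>r > 2\<close> puts the unit disc inside
  the region where this applies.\<close>

lemma second_difference_bound:
  fixes h :: "complex \<Rightarrow> complex"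
  assumes hol: "h holomorphic_on ball c r" and bd: "\<And>w. w \<in> ball c r \<Longrightarrow> norm (h w) \<le> B"
    and r: "r > 2"
  shows "norm (h (c - 1) - 2 * h c + h (c + 1)) \<le> 8 * B / r\<^sup>2"
proof -
  define \<rho> where "\<rho> = r / 2"
  have \<rho>: "\<rho> > 1" using r by (simp add: \<rho>_def)
  have fd: "(h has_field_derivative deriv h w) (at w)"
           "(deriv h has_field_derivative deriv (deriv h) w) (at w)" if "w \<in> ball c r" for w
    using holomorphic_derivI[OF hol open_ball that]
      holomorphic_derivI[OF holomorphic_deriv[OF hol open_ball] open_ball that] by auto
  have in_ball: "w \<in> ball c r" if "w \<in> cball c 1" for w
    using that r by auto
  have d2: "norm (deriv (deriv h) w) \<le> 8 * B / r\<^sup>2" if w: "norm (w - c) < r / 2" for w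
  proof -
    have sub: "cball w \<rho> \<subseteq> ball c r"
    proof
      fix v assume "v \<in> cball w \<rho>"
      hence "dist c v < \<rho> + r / 2"
        using w dist_triangle[of c v w] by (auto simp: dist_norm norm_minus_commute)
      thus "v \<in> ball c r" by (simp add: \<rho>_def)
    qed
    have "norm ((deriv ^^ 2) h w) \<le> fact 2 * B / \<rho> ^ 2"
    proof (rule Cauchy_inequality)
      show "h holomorphic_on ball w \<rho>"
        using hol sub by (meson ball_subset_cball holomorphic_on_subset)
      show "continuous_on (cball w \<rho>) h"
        using hol sub by (meson holomorphic_on_imp_continuous_on holomorphic_on_subset)
      show "norm (h x) \<le> B" if "norm (w - x) = \<rho>" for x
        by (rule bd) (use sub that in \<open>auto simp: dist_norm subset_iff\<close>)
    qed (use \<rho> in auto)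
    thus ?thesis by (simp add: \<rho>_def eval_nat_numeral)
  qed
  define g where "g = (\<lambda>w. h (w + 1) - h w)"
  have cvx: "convex (closed_segment (c - 1) c)" by simp
  have seg: "norm (w - c) \<le> 1" if "w \<in> closed_segment (c - 1) c" for w
    using segment_bound(2)[OF that] by simp
  have seg1: "norm (w + 1 - c) \<le> 1" if "w \<in> closed_segment (c - 1) c" for w
  proof -
    have "norm (w - (c - 1)) \<le> norm (c - (c - 1))" using segment_bound(1)[OF that] by simp
    thus ?thesis by (simp add: algebra_simps)
  qed
  have "norm (g c - g (c - 1)) \<le> 8 * B / r\<^sup>2 * norm (c - (c - 1))"
  proof (rule field_differentiable_bound[OF cvx])
    fix w assume w: "w \<in> closed_segment (c - 1) c"
    have mem: "w \<in> ball c r" "w + 1 \<in> ball c r"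
      using seg[OF w] seg1[OF w] r by (auto simp: dist_norm norm_minus_commute)
    have "((\<lambda>w. h (w + 1)) has_field_derivative deriv h (w + 1)) (at w)"
      using fd(1)[OF mem(2)] by (simp add: DERIV_shift)
    thus "(g has_field_derivative (deriv h (w + 1) - deriv h w)) (at w within closed_segment (c - 1) c)"
      unfolding g_def using fd(1)[OF mem(1)]
      by (intro has_field_derivative_at_within[OF DERIV_diff])
    have "norm (deriv h (w + 1) - deriv h w) \<le> 8 * B / r\<^sup>2 * norm ((w + 1) - w)"
    proof (rule field_differentiable_bound[of "cball c 1"])
      show "(deriv h has_field_derivative deriv (deriv h) v) (at v within cball c 1)"
        if "v \<in> cball c 1" for v
        using fd(2)[OF in_ball[OF that]] has_field_derivative_at_within by blast
      show "norm (deriv (deriv h) v) \<le> 8 * B / r\<^sup>2" if "v \<in> cball c 1" for v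
        by (rule d2) (use that r in \<open>auto simp: dist_norm norm_minus_commute\<close>)
    qed (use seg[OF w] seg1[OF w] in \<open>auto simp: dist_norm norm_minus_commute\<close>)
    thus "norm (deriv h (w + 1) - deriv h w) \<le> 8 * B / r\<^sup>2" by simp
  qed auto
  thus ?thesis by (simp add: g_def algebra_simps)
qed

text \<open>Subtracting \<open>f (2 * K) / 2\<close> averages the partial sums of lengths
  \<open>2 * K\<close> and \<open>2 * K + 1\<close>. The boundary term, which need not tend to 0
  when Re s \<le> 0, is thus absorbed into the second differences.\<close>

lemma alternating_sum_second_differences:
  fixes f :: "nat \<Rightarrow> 'a::field_char_0"
  shows "(\<Sum>m<2 * K. (-1) ^ (m + 1) * f m) - f (2 * K) / 2 =
         - f 0 / 2 - (\<Sum>k<K. f (2 * k) - 2 * f (2 * k + 1) + f (2 * k + 2)) / 2"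
  by (induction K) (simp_all add: field_simps)

section \<open>Growth of the summand and decay of its second differences\<close>

lemma norm_powr_complex_le:
  fixes w s :: complex
  assumes "w \<noteq> 0"
  shows "norm (w powr s) \<le> norm w powr Re s * exp (pi * norm s)"
proof -
  \<comment> \<open>The principal argument is bounded by pi, so the angular factor of the power is
    controlled by \<open>s\<close> alone.\<close>
  have "\<bar>Im (Ln w)\<bar> \<le> pi"
    using Im_Ln_le_pi[OF assms] mpi_less_Im_Ln[OF assms] by linarith
  hence "\<bar>Im s * Im (Ln w)\<bar> \<le> norm s * pi"
    unfolding abs_mult by (intro mult_mono abs_Im_le_cmod) auto
  hence "- (Im s * Im (Ln w)) \<le> norm s * pi" by linarith
  hence "Re s * ln (norm w) - Im s * Im (Ln w) \<le> Re s * ln (norm w) + pi * norm s"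
    by (simp add: mult.commute)
  thus ?thesis using assms by (simp add: powr_def flip: exp_add)
qed

text \<open>This extends the summand of the alternating series, without its sign, from integers to
  complex \<open>w\<close>, so that Cauchy estimates in \<open>w\<close> become available.\<close>

definition shifted_prod :: "nat \<Rightarrow> (nat \<Rightarrow> complex) \<Rightarrow> complex \<Rightarrow> complex \<Rightarrow> complex" where
  "shifted_prod n z s w = (\<Prod>j=1..n. (w + z j) powr (- s))"

lemma shifted_prod_eq_exp:
  assumes "\<And>j. j \<in> {1..n} \<Longrightarrow> w + z j \<noteq> 0"
  shows "shifted_prod n z s w = exp (- s * (\<Sum>j=1..n. Ln (w + z j)))"
  using assms by (simp add: shifted_prod_def powr_def sum_distrib_left exp_sum flip: sum_negf)

text \<open>Each of the \<open>n\<close> factors grows at most like the power 1/(2n) of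
  \<open>t\<close>, so the product grows at most like its square root. The lower bound 1 on the
  moduli allows the exponent -Re s to be raised to 1/(2n).\<close>

lemma shifted_prod_norm_le:
  assumes n: "n \<ge> 1" and s: "norm s \<le> R" "Re s > - 1 / (2 * n)"
    and w: "\<And>j. j \<in> {1..n} \<Longrightarrow> 1 \<le> norm (w + z j) \<and> norm (w + z j) \<le> t"
  shows "norm (shifted_prod n z s w) \<le> t powr (1/2) * exp (pi * R) ^ n"
proof -
  have t: "1 \<le> t" using w[of 1] n by auto
  have "norm (shifted_prod n z s w) = (\<Prod>j=1..n. norm ((w + z j) powr (- s)))"
    by (simp add: shifted_prod_def prod_norm)
  also have "\<dots> \<le> (\<Prod>j=1..n. t powr (1 / (2 * n)) * exp (pi * R))"
  proof (intro prod_mono conjI)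
    fix j assume j: "j \<in> {1..n}"
    have "norm ((w + z j) powr (- s)) \<le> norm (w + z j) powr Re (- s) * exp (pi * norm (- s))"
      by (rule norm_powr_complex_le) (use w[OF j] in auto)
    also have "\<dots> \<le> t powr (1 / (2 * n)) * exp (pi * R)"
    proof (intro mult_mono)
      have "norm (w + z j) powr Re (- s) \<le> norm (w + z j) powr (1 / (2 * n))"
        by (rule powr_mono) (use s w[OF j] in auto)
      also have "\<dots> \<le> t powr (1 / (2 * n))"
        by (rule powr_mono2) (use w[OF j] in auto)
      finally show "norm (w + z j) powr Re (- s) \<le> t powr (1 / (2 * n))" .
    qed (use s in auto)
    finally show "norm ((w + z j) powr (- s)) \<le> t powr (1 / (2 * n)) * exp (pi * R)" .
  qed auto
  also have "\<dots> = t powr (1/2) * exp (pi * R) ^ n"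
  proof -
    have "(t powr (1 / (2 * n))) ^ n = t powr (n * (1 / (2 * n)))"
      using t by (simp add: powr_power mult.commute)
    also have "\<dots> = t powr (1/2)" using n by simp
    finally show ?thesis by (simp add: power_mult_distrib)
  qed
  finally show ?thesis .
qed

text \<open>Growth of order 1/2 on a disc of radius \<open>m / 2\<close>, divided by the square of
  that radius, leaves the summable exponent -3/2. The bound \<open>m \<ge> 5\<close> makes this
  radius exceed 2.\<close>

lemma shifted_prod_second_difference:
  assumes n: "n \<ge> 1" and s: "norm s \<le> R" "Re s > - 1 / (2 * n)"
    and m: "m \<ge> 5" "\<And>j. j \<in> {1..n} \<Longrightarrow> norm (z j) \<le> real m / 4"
  defines "h \<equiv> shifted_prod n z s"
  shows "norm (h (of_nat m - 1) - 2 * h (of_nat m) + h (of_nat m + 1))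
           \<le> 64 * exp (pi * R) ^ n * real m powr (- 3/2)"
proof -
  \<comment> \<open>Every \<open>w + z j\<close> stays within 3m/4 of \<open>m\<close>, hence in the
    right half-plane and away from the branch cut.\<close>
  have near: "Re (w + z j) > 0 \<and> 1 \<le> norm (w + z j) \<and> norm (w + z j) \<le> 2 * real m"
    if w: "w \<in> ball (of_nat m) (m / 2)" and j: "j \<in> {1..n}" for w j
  proof -
    have "norm (w - of_nat m) < m / 2"
      using w by (simp add: dist_norm norm_minus_commute)
    moreover have "norm (w + z j - of_nat m) \<le> norm (w - of_nat m) + norm (z j)"
      using norm_triangle_ineq[of "w - of_nat m" "z j"] by (simp add: algebra_simps)
    ultimately have d: "norm (w + z j - of_nat m) \<le> 3 * m / 4"
      using m(2)[OF j] by linarith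
    have "norm (w + z j) \<le> norm (of_nat m :: complex) + norm (w + z j - of_nat m)"
      using norm_triangle_ineq[of "of_nat m" "w + z j - of_nat m"] by simp
    moreover have "\<bar>Re (w + z j - of_nat m)\<bar> \<le> norm (w + z j - of_nat m)"
      by (rule abs_Re_le_cmod)
    moreover have "\<bar>Re (w + z j)\<bar> \<le> norm (w + z j)"
      by (rule abs_Re_le_cmod)
    ultimately show ?thesis
      using d m(1) by (auto simp: norm_of_nat)
  qed
  define B where "B = (2 * real m) powr (1/2) * exp (pi * R) ^ n"
  have "norm (h (of_nat m - 1) - 2 * h (of_nat m) + h (of_nat m + 1)) \<le> 8 * B / (real m / 2)\<^sup>2"
  proof (rule second_difference_bound)
    show "h holomorphic_on ball (of_nat m) (m / 2)"
      unfolding h_def shifted_prod_def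
      by (intro holomorphic_intros)
         (use near in \<open>force simp: complex_nonpos_Reals_iff\<close>)
    show "norm (h w) \<le> B" if "w \<in> ball (of_nat m) (m / 2)" for w
      unfolding h_def B_def
      by (rule shifted_prod_norm_le[OF n s]) (use near[OF that] in auto)
  qed (use m in auto)
  also have "\<dots> = 32 * 2 powr (1/2) * exp (pi * R) ^ n * (real m powr (1/2) / real m powr 2)"
    using m(1) by (simp add: B_def powr_mult power2_eq_square powr_numeral)
  also have "real m powr (1/2) / real m powr 2 = real m powr (- 3/2)"
    unfolding powr_diff[symmetric] by simp
  \<comment> \<open>The square root of 2 is rounded up to 2, giving the constant 64.\<close>
  also have "32 * 2 powr (1/2) * exp (pi * R) ^ n * real m powr (- 3/2)
      \<le> 32 * 2 powr 1 * exp (pi * R) ^ n * real m powr (- 3/2)"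
    by (intro mult_mono powr_mono) (use m(1) in auto)
  finally show ?thesis by simp
qed

lemma tendsto_shifted_powr:
  fixes s z :: complex
  assumes s: "Re s > 0"
  shows "(\<lambda>m. (of_nat m + z) powr (- s)) \<longlonglongrightarrow> 0"
proof (rule Lim_null_comparison)
  have inf: "filterlim (\<lambda>m. norm (of_nat m + z)) at_top sequentially"
    by (intro filterlim_at_infinity_imp_norm_at_top
          tendsto_add_filterlim_at_infinity'[OF tendsto_of_nat tendsto_const])
  show "eventually (\<lambda>m. norm ((of_nat m + z) powr (- s))
          \<le> norm (of_nat m + z) powr Re (- s) * exp (pi * norm (- s))) sequentially"
    using inf[unfolded filterlim_at_top, rule_format, of 1]
    by eventually_elim (rule norm_powr_complex_le, auto)
  have "(\<lambda>m. norm (of_nat m + z) powr Re (- s)) \<longlonglongrightarrow> 0"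
    by (rule tendsto_neg_powr[OF _ inf]) (use s in simp)
  thus "(\<lambda>m. norm (of_nat m + z) powr Re (- s) * exp (pi * norm (- s))) \<longlonglongrightarrow> 0"
    by (rule tendsto_mult_left_zero)
qed

section \<open>The Wallis-type product for a single parameter\<close>

lemma half_not_nonpos_Ints:
  fixes z :: complex
  assumes "z \<notin> \<int>\<^sub>\<le>\<^sub>0"
  shows "z / 2 \<notin> \<int>\<^sub>\<le>\<^sub>0" and "z / 2 + 1 / 2 \<notin> \<int>\<^sub>\<le>\<^sub>0"
proof -
  show "z / 2 \<notin> \<int>\<^sub>\<le>\<^sub>0"
  proof
    assume "z / 2 \<in> \<int>\<^sub>\<le>\<^sub>0"
    then obtain k where "z / 2 = - of_nat k" by (auto elim!: nonpos_Ints_cases')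
    hence "z = - of_nat (2 * k)" by (simp add: field_simps)
    thus False using assms by (metis minus_of_nat_in_nonpos_Ints)
  qed
  show "z / 2 + 1 / 2 \<notin> \<int>\<^sub>\<le>\<^sub>0"
  proof
    assume "z / 2 + 1 / 2 \<in> \<int>\<^sub>\<le>\<^sub>0"
    then obtain k where "z / 2 + 1 / 2 = - of_nat k" by (auto elim!: nonpos_Ints_cases')
    hence "z = - of_nat (2 * k + 1)" by (simp add: field_simps eq_neg_iff_add_eq_0)
    thus False using assms by (metis minus_of_nat_in_nonpos_Ints)
  qed
qed

lemma of_nat_add_nonzero:
  fixes z :: "'a::ring_1"
  assumes "z \<notin> \<int>\<^sub>\<le>\<^sub>0"
  shows "of_nat m + z \<noteq> 0"
  using assms by (metis add_eq_0_iff minus_of_nat_in_nonpos_Ints)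

text \<open>Exponentiation removes the branch choice, and each consecutive pair contributes (2K +
  z)/(2K + 1 + z), which after halving is a ratio of Pochhammer factors.\<close>

lemma exp_alternating_Ln_sum:
  fixes z :: complex
  assumes z: "z \<notin> \<int>\<^sub>\<le>\<^sub>0"
  shows "exp (\<Sum>m<2 * K. (-1) ^ m * Ln (of_nat m + z)) =
         pochhammer (z / 2) K / pochhammer (z / 2 + 1 / 2) K"
proof (induction K)
  case (Suc K)
  have nz: "of_nat (2 * K) + z \<noteq> 0" "of_nat (2 * K + 1) + z \<noteq> 0"
    using of_nat_add_nonzero[OF z] by blast+
  have "exp (\<Sum>m<2 * Suc K. (-1) ^ m * Ln (of_nat m + z)) =
        exp (\<Sum>m<2 * K. (-1) ^ m * Ln (of_nat m + z)) *
        (exp (Ln (of_nat (2 * K) + z)) / exp (Ln (of_nat (2 * K + 1) + z)))"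
    by (simp add: exp_add exp_diff)
  also have "exp (Ln (of_nat (2 * K) + z)) / exp (Ln (of_nat (2 * K + 1) + z)) =
        (of_nat (2 * K) + z) / (of_nat (2 * K + 1) + z)"
    unfolding exp_Ln[OF nz(1)] exp_Ln[OF nz(2)] ..
  also have "\<dots> = (z / 2 + of_nat K) / (z / 2 + 1 / 2 + of_nat K)"
  proof -
    have "of_nat (2 * K) + z = 2 * (z / 2 + of_nat K)"
         "of_nat (2 * K + 1) + z = 2 * (z / 2 + 1 / 2 + of_nat K)"
      by (simp_all add: field_simps)
    thus ?thesis by (simp only: mult_divide_mult_cancel_left_if) simp
  qed
  finally show ?case by (simp add: Suc.IH pochhammer_Suc)
qed simp

text \<open>The Pochhammer ratio is a ratio of two \<open>Gamma_series\<close> up to a factor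
  N^(1/2); the half logarithm at the endpoint supplies that factor together with a limit of
  \<open>csqrt 2\<close>.\<close>

lemma tendsto_alternating_product:
  fixes z :: complex
  assumes z: "z \<notin> \<int>\<^sub>\<le>\<^sub>0"
  shows "(\<lambda>K. exp ((\<Sum>m<2 * K. (-1) ^ m * Ln (of_nat m + z)) + Ln (of_nat (2 * K) + z) / 2))
           \<longlonglongrightarrow> of_real (sqrt (pi / 2)) / mod_Gamma z"
    (is "?f \<longlonglongrightarrow> _")
proof -
  note z' = half_not_nonpos_Ints[OF z]
  define g where "g = (\<lambda>N. Gamma_series (z / 2 + 1 / 2) N / Gamma_series (z / 2) N)"
  have arg: "(\<lambda>N. 2 + (2 + z) / of_nat N) \<longlonglongrightarrow> 2 + 0"
    by (intro tendsto_intros lim_const_over_n)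
  have sq: "(\<lambda>N. csqrt (2 + (2 + z) / of_nat N)) \<longlonglongrightarrow> csqrt 2"
    by (rule isCont_tendsto_compose[OF continuous_at_csqrt]) (use arg in auto)
  have "(\<lambda>N. g N * csqrt (2 + (2 + z) / of_nat N))
          \<longlonglongrightarrow> Gamma (z / 2 + 1 / 2) / Gamma (z / 2) * csqrt 2"
    unfolding g_def by (intro tendsto_intros sq) (use z' in \<open>auto simp: Gamma_eq_zero_iff\<close>)
  also have "Gamma (z / 2 + 1 / 2) / Gamma (z / 2) * csqrt 2 = of_real (sqrt (pi / 2)) / mod_Gamma z"
  proof -
    have nz: "Gamma z \<noteq> 0" "Gamma (z / 2) \<noteq> 0"
      using z z' by (auto simp: Gamma_eq_zero_iff)
    \<comment> \<open>The duplication formula is written with the same exponential as in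
      \<open>mod_Gamma_eq\<close>. It makes the Gamma ratio equal to sqrt pi / (2 *
      \<open>mod_Gamma z\<close>).\<close>
    have dup: "Gamma (z / 2) * Gamma (z / 2 + 1 / 2) =
        2 / exp (of_real (ln 2) * z) * of_real (sqrt pi) * Gamma z"
      using Gamma_legendre_duplication[OF z'] exp_of_real[of "ln 2", where 'a = complex]
      by (simp add: exp_diff algebra_simps)
    have "csqrt 2 * csqrt 2 = 2" by (metis power2_csqrt power2_eq_square)
    moreover have "csqrt 2 = of_real (sqrt 2)" using csqrt_of_real_nonneg[of 2] by simp
    ultimately show ?thesis
      unfolding mod_Gamma_eq[OF z] using nz dup
      by (simp add: real_sqrt_divide field_simps power2_eq_square)
  qed
  finally have lim: "(\<lambda>N. g N * csqrt (2 + (2 + z) / of_nat N))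
          \<longlonglongrightarrow> of_real (sqrt (pi / 2)) / mod_Gamma z" .
  \<comment> \<open>\<open>Gamma_series\<close> at \<open>N\<close> contains a Pochhammer symbol of
    length \<open>Suc N\<close>, which causes the index shift.\<close>
  have "eventually (\<lambda>N. g N * csqrt (2 + (2 + z) / of_nat N) = ?f (Suc N)) sequentially"
    using eventually_gt_at_top[of 0]
  proof eventually_elim
    case (elim N)
    have factor: "of_nat (2 * Suc N) + z = of_nat N * (2 + (2 + z) / of_nat N)"
      using elim by (simp add: field_simps)
    hence nz: "2 + (2 + z) / of_nat N \<noteq> 0"
      using of_nat_add_nonzero[OF z, of "2 * Suc N"] by auto
    \<comment> \<open>The extracted factor \<open>N\<close> is a positive real, so the logarithm
      splits without a multiple of 2 pi i.\<close>
    have "Ln (of_nat (2 * Suc N) + z) = of_real (ln (real N)) + Ln (2 + (2 + z) / of_nat N)"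
      unfolding factor using Ln_times_of_real[of "real N" "2 + (2 + z) / of_nat N"] nz elim by simp
    hence e: "exp (Ln (of_nat (2 * Suc N) + z) / 2) =
        exp (of_real (ln (real N)) / 2) * csqrt (2 + (2 + z) / of_nat N)"
      using nz by (simp add: csqrt_exp_Ln add_divide_distrib exp_add)
    have g: "g N = pochhammer (z / 2) (Suc N) / pochhammer (z / 2 + 1 / 2) (Suc N) *
        exp (of_real (ln (real N)) / 2)"
      by (simp add: g_def Gamma_series_def exp_add algebra_simps)
    show ?case
      unfolding exp_add exp_alternating_Ln_sum[OF z] e g by simp
  qed
  with lim have "(\<lambda>N. ?f (Suc N)) \<longlonglongrightarrow> of_real (sqrt (pi / 2)) / mod_Gamma z"
    by (rule Lim_transform_eventually)
  thus ?thesis by (rule LIMSEQ_imp_Suc)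
qed

section \<open>Analytic continuation and evaluation of the derivative at 0\<close>

theorem theorem1p1:
  fixes n :: nat and z :: "nat \<Rightarrow> complex"
  assumes "n \<ge> 1"
    and "\<And>j. j \<in> {1..n} \<Longrightarrow> z j \<notin> \<int>\<^sub>\<le>\<^sub>0"
  shows "(\<exists>F. alt_zeta_continuation n z F) \<and>
         alt_zeta_prod n z = of_real (sqrt (pi / 2)) ^ n / (\<Prod>j=1..n. mod_Gamma (z j))"
proof -
  define h where "h = shifted_prod n z"
  define P where "P = (\<lambda>K s. (\<Sum>m<2 * K. (-1) ^ (m + 1) * h s (of_nat m)) - h s (of_nat (2 * K)) / 2)"
  define D where "D = (\<lambda>k s. h s (of_nat (2 * k)) - 2 * h s (of_nat (2 * k + 1)) + h s (of_nat (2 * k + 2)))"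
  define F where "F = (\<lambda>s. - h s 0 / 2 - (\<Sum>k. D k s) / 2)"
  define U where "U = {s. Re s > - 1 / (2 * real n)}"
  define L where "L = (\<lambda>m::nat. \<Sum>j=1..n. Ln (of_nat m + z j))"
  have P_eq: "P K s = - h s 0 / 2 - (\<Sum>k<K. D k s) / 2" for K s
    unfolding P_def D_def using alternating_sum_second_differences[of "\<lambda>m. h s (of_nat m)" K] by simp
  \<comment> \<open>At integer points each summand is an exponential in \<open>s\<close>, hence
    entire in \<open>s\<close>, even if some \<open>of_nat m + z j\<close> lies on the branch
    cut.\<close>
  have h_exp: "h s (of_nat m) = exp (- s * L m)" for s m
    unfolding h_def L_def by (rule shifted_prod_eq_exp) (use of_nat_add_nonzero assms(2) in blast)
  have "open U" unfolding U_def by (rule open_halfspace_Re_gt)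
  have "convex U" unfolding U_def by (rule convex_halfspace_Re_gt)
  have "0 \<in> U" using assms(1) by (simp add: U_def)
  have U_pos: "s \<in> U" if "Re s > 0" for s
    using that by (simp add: U_def) (smt (verit) divide_nonneg_nonneg of_nat_0_le_iff)
  \<comment> \<open>The factor \<open>exp (pi * R) ^ n\<close> depends on a bound for the modulus of
    \<open>s\<close>, so uniform convergence is proved on bounded pieces of
    \<open>U\<close>.\<close>
  define W where "W = (\<lambda>R. U \<inter> ball 0 R)"
  have unif: "uniform_limit (W R) P F sequentially" for R
  proof -
    define N where "N = nat \<lceil>4 * (\<Sum>j=1..n. norm (z j))\<rceil> + 5"
    have N: "norm (z j) \<le> real m / 4" if "m \<ge> N" "j \<in> {1..n}" for m j
    proof -
      have "norm (z j) \<le> (\<Sum>j=1..n. norm (z j))"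
        by (rule member_le_sum) (use that in auto)
      also have "\<dots> \<le> real N / 4"
        using real_nat_ceiling_ge[of "4 * (\<Sum>j=1..n. norm (z j))"] unfolding N_def by simp
      finally show ?thesis using that by simp
    qed
    have "N \<ge> 5" by (simp add: N_def)
    define C where "C = 64 * exp (pi * R) ^ n"
    have ev: "eventually (\<lambda>k. \<forall>s\<in>W R. norm (D k s) \<le> C * real (Suc k) powr (- 3/2)) sequentially"
      using eventually_ge_at_top[of N]
    proof eventually_elim
      case (elim k)
      show ?case
      proof
        fix s assume s: "s \<in> W R"
        \<comment> \<open>The second difference \<open>D k\<close> is centred at
          \<open>2 * k + 1\<close>.\<close>
        have eqs: "of_nat (2 * k) = of_nat (2 * k + 1) - (1::complex)"
            "of_nat (2 * k + 2) = of_nat (2 * k + 1) + (1::complex)" by simp_all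
        have "norm (D k s) \<le> C * real (2 * k + 1) powr (- 3/2)"
          unfolding D_def C_def eqs h_def
          by (rule shifted_prod_second_difference[OF assms(1)])
             (use s elim N[of "2 * k + 1"] \<open>N \<ge> 5\<close> in \<open>auto simp: W_def U_def\<close>)
        also have "\<dots> \<le> C * real (Suc k) powr (- 3/2)"
          by (intro mult_left_mono powr_mono2') (auto simp: C_def)
        finally show "norm (D k s) \<le> C * real (Suc k) powr (- 3/2)" .
      qed
    qed
    have "summable (\<lambda>k. C * real (Suc k) powr (- 3/2))"
      by (intro summable_mult, subst summable_Suc_iff) (simp add: summable_real_powr_iff)
    from Weierstrass_m_test_ev[OF ev this]
    have "uniform_limit (W R) (\<lambda>K s. \<Sum>k<K. D k s) (\<lambda>s. \<Sum>k. D k s) sequentially" .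
    thus ?thesis
      unfolding F_def P_eq by (intro uniform_limit_intros)
  qed
  have W_open: "open (W R)" for R
    unfolding W_def using \<open>open U\<close> by auto
  have P_deriv: "(P K has_field_derivative
      (\<Sum>m<2 * K. (-1) ^ (m + 1) * (- L m * exp (- s * L m))) - (- L (2 * K) * exp (- s * L (2 * K))) / 2) (at s)" for K s
    unfolding P_def h_exp by (auto intro!: derivative_eq_intros sum.cong)
  have F_hol: "F holomorphic_on U"
  proof (rule holomorphic_uniform_sequence[OF \<open>open U\<close>])
    show "P K holomorphic_on U" for K
      using P_deriv by (auto simp: holomorphic_on_def field_differentiable_def
          intro: has_field_derivative_at_within)
    fix s assume "s \<in> U"
    hence "s \<in> W (norm s + 1)" by (simp add: W_def)
    then obtain d where "d > 0" "cball s d \<subseteq> W (norm s + 1)"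
      using W_open open_contains_cball by blast
    thus "\<exists>d>0. cball s d \<subseteq> U \<and> uniform_limit (cball s d) P F sequentially"
      using uniform_limit_on_subset[OF unif] by (auto simp: W_def)
  qed
  have sums: "alt_zeta_term n z s sums F s" if s: "Re s > 0" for s
  proof -
    have "s \<in> W (norm s + 1)" using U_pos[OF s] by (simp add: W_def)
    hence lim: "(\<lambda>K. P K s) \<longlonglongrightarrow> F s"
      by (rule tendsto_uniform_limitI[OF unif])
    have "(\<lambda>m. h s (of_nat m)) \<longlonglongrightarrow> (\<Prod>j=1..n. 0)"
      unfolding h_def shifted_prod_def by (intro tendsto_prod tendsto_shifted_powr s)
    \<comment> \<open>Here \<open>n \<ge> 1\<close> matters: an empty product would be 1.\<close>
    hence h0: "(\<lambda>m. h s (of_nat m)) \<longlonglongrightarrow> 0" using assms(1) by (simp add: power_0_left)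
    have h0': "(\<lambda>K. h s (of_nat (2 * K))) \<longlonglongrightarrow> 0"
      using LIMSEQ_subseq_LIMSEQ[OF h0, of "\<lambda>K. 2 * K"] by (simp add: strict_mono_def o_def)
    have "(\<lambda>K. P K s + h s (of_nat (2 * K)) / 2) \<longlonglongrightarrow> F s + 0 / 2"
      by (intro tendsto_intros lim h0') auto
    hence even: "(\<lambda>K. \<Sum>m<2 * K. alt_zeta_term n z s m) \<longlonglongrightarrow> F s"
      by (simp add: P_def h_def shifted_prod_def alt_zeta_term_def)
    \<comment> \<open>The term at the even index \<open>2 * K\<close> carries a minus sign, so the
      next partial sum is obtained by subtraction.\<close>
    from tendsto_diff[OF this h0']
    have odd: "(\<lambda>K. \<Sum>m<2 * K + 1. alt_zeta_term n z s m) \<longlonglongrightarrow> F s"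
      by (simp add: h_def shifted_prod_def alt_zeta_term_def)
    show ?thesis
      unfolding sums_def by (rule tendsto_even_odd[OF even odd])
  qed
  have cont: "alt_zeta_continuation n z F"
    unfolding alt_zeta_continuation_def
    using \<open>open U\<close> convex_connected[OF \<open>convex U\<close>] \<open>0 \<in> U\<close> U_pos F_hol sums by blast
  \<comment> \<open>Uniform convergence of holomorphic functions on the neighbourhood
    \<open>W 1\<close> of 0 passes to derivatives.\<close>
  have "(\<lambda>K. deriv (P K) 0) \<longlonglongrightarrow> deriv F 0"
  proof (rule deriv_complex_uniform_limit[OF unif[of 1]])
    show "eventually (\<lambda>K. P K holomorphic_on W 1) sequentially"
      using P_deriv by (auto simp: holomorphic_on_def field_differentiable_def
          intro!: always_eventually intro: has_field_derivative_at_within)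
  qed (use W_open \<open>0 \<in> U\<close> in \<open>auto simp: W_def\<close>)
  moreover have "deriv (P K) 0 =
      (\<Sum>j=1..n. (\<Sum>m<2 * K. (-1) ^ m * Ln (of_nat m + z j)) + Ln (of_nat (2 * K) + z j) / 2)" for K
  proof -
    \<comment> \<open>The minus sign from differentiating \<open>exp (- s * L m)\<close> turns the
      sign (-1)^(m+1) into (-1)^m and makes the endpoint correction positive.\<close>
    have "deriv (P K) 0 = (\<Sum>m<2 * K. (-1) ^ m * L m) + L (2 * K) / 2"
      using DERIV_imp_deriv[OF P_deriv[of K 0]] by simp
    also have "(\<Sum>m<2 * K. (-1) ^ m * L m) = (\<Sum>j=1..n. \<Sum>m<2 * K. (-1) ^ m * Ln (of_nat m + z j))"
      unfolding L_def sum_distrib_left by (rule sum.swap)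
    finally show ?thesis by (simp add: L_def sum.distrib sum_divide_distrib)
  qed
  ultimately have "(\<lambda>K. exp (\<Sum>j=1..n. (\<Sum>m<2 * K. (-1) ^ m * Ln (of_nat m + z j)) +
      Ln (of_nat (2 * K) + z j) / 2)) \<longlonglongrightarrow> exp (deriv F 0)"
    by (simp only:) (rule tendsto_exp)
  moreover have "(\<lambda>K. exp (\<Sum>j=1..n. (\<Sum>m<2 * K. (-1) ^ m * Ln (of_nat m + z j)) +
      Ln (of_nat (2 * K) + z j) / 2)) \<longlonglongrightarrow> (\<Prod>j=1..n. of_real (sqrt (pi / 2)) / mod_Gamma (z j))"
    unfolding exp_sum[OF finite_atLeastAtMost]
    by (intro tendsto_prod tendsto_alternating_product assms(2))
  ultimately have "exp (deriv F 0) = (\<Prod>j=1..n. of_real (sqrt (pi / 2)) / mod_Gamma (z j))"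
    by (rule LIMSEQ_unique)
  thus ?thesis
    using cont alt_zeta_prod_eqI[OF cont] by (auto simp: prod_dividef)
qed

end
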